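(* Let $n\ge 1$. The dual of the type $B$ permutohedron $\operatorname{Perm}(B_n)$ is a simplicial polytope whose boundary complex is combinatorially equivalent (isomorphic as a simplicial complex) to the order complex $\triangle\big(\widehat{I}(P([1,n]))-\{\emptyset,[\emptyset,[1,n]]\}\big)$.
   Context: $[1,n]=\{1,2,\ldots,n\}$. The type $B$ permutohedron $\operatorname{Perm}(B_n)$ is the convex hull in $\mathbb{R}^n$ of all points $(\pm\pi(1),\pm\pi(2),\ldots,\pm\pi(n))$, where $\pi$ ranges over all permutations of $[1,n]$ and all choices of signs are allowed. $P([1,n])$ is the Boolean algebra of rank $n$, that is, the set of all subsets of $[1,n]$ ordered by inclusion. For a graded poset $P$, $\widehat{I}(P)$ (the graded poset of intervals) is the set of all intervals $[u,v]=\{w\in P: u\le w\le v\}$, $u\le v$, of $P$, together with the empty set, ordered by inclusion. So $\emptyset$ and $[\emptyset,[1,n]]$ are the minimum and maximum elements of $\widehat{I}(P([1,n]))$. The order complex $\triangle(Q)$ of a finite poset $Q$ is the simplicial complex on the vertex set $Q$ whose faces are the chains of $Q$. The dual of a polytope is any polytope whose face lattice is the order dual of the face lattice of the given polytope. *)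

theory Defs
  imports "HOL-Analysis.Analysis"
begin

text \<open>
  The coordinates of \<open>real ^ 'n\<close> are indexed by an arbitrary finite type with
  \<open>n = CARD('n)\<close> elements rather than by \<open>{1..n}\<close>; accordingly a permutation of \<open>{1..n}\<close>
  becomes a bijection from the index type onto \<open>{1..n}\<close>.
\<close>
definition permutohedron_B :: "(real ^ 'n) set" where
  "permutohedron_B = convex hull
     {\<chi> i. s i * real (p i) | (p :: 'n \<Rightarrow> nat) s.
        bij_betw p UNIV {1..CARD('n)} \<and> (\<forall>i. s i \<in> {1, -1})}"

text \<open>
  Posets are carrier sets in a type with an order. In particular, a family of sets is ordered by
  inclusion.
\<close>
definition interval_in :: "'a::order set \<Rightarrow> 'a \<Rightarrow> 'a \<Rightarrow> 'a set" where
  "interval_in P u v = {w \<in> P. u \<le> w \<and> w \<le> v}"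

definition interval_poset :: "'a::order set \<Rightarrow> 'a set set" where
  "interval_poset P = insert {} {interval_in P u v | u v. u \<in> P \<and> v \<in> P \<and> u \<le> v}"

text \<open>
  Abstract simplicial complexes are represented by their sets of faces, the empty face included;
  the vertex set of \<open>K\<close> is \<open>\<Union>K\<close>.
\<close>
definition order_complex :: "'a::order set \<Rightarrow> 'a set set" where
  "order_complex Q = {C. C \<subseteq> Q \<and> Complete_Partial_Order.chain (\<le>) C}"

definition complex_isomorphic :: "'a set set \<Rightarrow> 'b set set \<Rightarrow> bool" where
  "complex_isomorphic K L \<longleftrightarrow>
     (\<exists>f. bij_betw f (\<Union>K) (\<Union>L) \<and> (\<forall>S. S \<subseteq> \<Union>K \<longrightarrow> (S \<in> K \<longleftrightarrow> f ` S \<in> L)))"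

text \<open>
  In the sense of \<^const>\<open>face_of\<close>, both the empty set and the polytope itself are faces, so the
  faces ordered by inclusion are the full face lattice.
\<close>
definition dual_polytope :: "'b::euclidean_space set \<Rightarrow> 'a::euclidean_space set \<Rightarrow> bool" where
  "dual_polytope Q P \<longleftrightarrow> polytope P \<and> polytope Q \<and>
     (\<exists>f. bij_betw f {F. F face_of P} {G. G face_of Q} \<and>
          (\<forall>F G. F face_of P \<longrightarrow> G face_of P \<longrightarrow> (F \<subseteq> G \<longleftrightarrow> f G \<subseteq> f F)))"

definition simplicial_polytope :: "'a::euclidean_space set \<Rightarrow> bool" where
  "simplicial_polytope Q \<longleftrightarrow> polytope Q \<and> (\<forall>F. F face_of Q \<and> F \<noteq> Q \<longrightarrow> (\<exists>k. k simplex F))"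

text \<open>
  For a simplicial polytope the boundary complex consists of the proper faces, which are simplices;
  as an abstract complex, each of them is represented by its vertex set.
\<close>
definition boundary_complex :: "'a::euclidean_space set \<Rightarrow> 'a set set" where
  "boundary_complex Q = {{v. v extreme_point_of F} | F. F face_of Q \<and> F \<noteq> Q}"

end

theory Submission
  imports Defs
begin

text \<open>
  An interval \<open>[A, B]\<close> is encoded as the sign vector that is \<open>1\<close> on \<open>A\<close>, \<open>0\<close> on \<open>B - A\<close> and
  \<open>-1\<close> off \<open>B\<close>; the interval \<open>[{}, {1..n}]\<close> becomes the zero vector, and inclusion of intervals
  becomes reverse extension of signs. Each nonzero sign vector \<open>\<sigma>\<close> is the normal of a supporting
  hyperplane of the permutohedron, and a vertex lies on it iff its coordinates of largest absolute
  value are those in the support of \<open>\<sigma>\<close>, with the signs of \<open>\<sigma>\<close>. Every linear functional is a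
  positive combination of a chain of sign vectors, so every nonempty face is the intersection of the
  permutohedron with the hyperplanes of a chain; the chain is recovered from its face, hence
  nonempty faces correspond to chains, with the order reversed. In a dual polytope the proper faces
  therefore form a Boolean lattice below each face, which forces them to be simplices.
\<close>

subsection \<open>Polar duality of polytopes\<close>

definition polar :: "'a::real_inner set \<Rightarrow> 'a set" where
  "polar S = {y. \<forall>x\<in>S. x \<bullet> y \<le> 1}"

text \<open>The face of the polar conjugate to \<open>F\<close>. At the extremes,
  \<open>F = {}\<close> gives all of \<open>polar S\<close>, and \<open>F = S\<close> with
  \<open>0 \<in> S\<close> gives \<open>{}\<close>, because \<open>0 \<bullet> y = 1\<close> is
  impossible.\<close>

definition polar_face :: "'a::real_inner set \<Rightarrow> 'a set \<Rightarrow> 'a set" where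
  "polar_face S F = {y \<in> polar S. \<forall>x\<in>F. x \<bullet> y = 1}"

lemma convex_polar: "convex (polar S)"
proof -
  have "polar S = (\<Inter>x\<in>S. {y. x \<bullet> y \<le> 1})"
    by (auto simp: polar_def)
  then show ?thesis
    by (simp add: convex_INT convex_halfspace_le)
qed

text \<open>For fixed \<open>y\<close> the condition cuts out a half-space in \<open>x\<close>,
  which contains the hull as soon as it contains \<open>V\<close>.\<close>

lemma polar_convex_hull: "polar (convex hull V) = polar V"
proof
  show "polar (convex hull V) \<subseteq> polar V"
    by (auto simp: polar_def hull_inc)
  show "polar V \<subseteq> polar (convex hull V)"
  proof
    fix y assume "y \<in> polar V"
    then have "V \<subseteq> {x. y \<bullet> x \<le> 1}"
      by (auto simp: polar_def inner_commute)
    then have "convex hull V \<subseteq> {x. y \<bullet> x \<le> 1}"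
      by (simp add: hull_minimal convex_halfspace_le)
    then show "y \<in> polar (convex hull V)"
      by (auto simp: polar_def inner_commute)
  qed
qed

text \<open>Bipolar theorem: a hyperplane strictly separating an outside point from \<open>S\<close>
  misses the origin, so it can be normalised to level 1; its normal is then an element of the polar
  that rules the point out.\<close>

lemma polar_polar:
  fixes S :: "'a::euclidean_space set"
  assumes "closed S" "convex S" "0 \<in> S"
  shows "polar (polar S) = S"
proof
  show "S \<subseteq> polar (polar S)"
    by (auto simp: polar_def inner_commute)
  show "polar (polar S) \<subseteq> S"
  proof (rule ccontr)
    assume "\<not> polar (polar S) \<subseteq> S"
    then obtain z where z: "z \<in> polar (polar S)" "z \<notin> S" by blast
    then obtain a b where ab: "a \<bullet> z < b" "\<And>x. x \<in> S \<Longrightarrow> b < a \<bullet> x"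
      using separating_hyperplane_closed_point assms by metis
    then have "b < 0"
      using ab(2)[OF \<open>0 \<in> S\<close>] by simp
    have "x \<bullet> ((1 / b) *\<^sub>R a) \<le> 1" if "x \<in> S" for x
      using ab(2)[OF that] \<open>b < 0\<close> by (simp add: field_simps inner_commute)
    then have "(1 / b) *\<^sub>R a \<in> polar S"
      by (simp add: polar_def)
    then have "((1 / b) *\<^sub>R a) \<bullet> z \<le> 1"
      using z(1) unfolding polar_def by blast
    then show False
      using ab(1) \<open>b < 0\<close> by (simp add: field_simps)
  qed
qed

text \<open>An element of the polar is tested against the point of a small ball in its own
  direction.\<close>

lemma bounded_polar:
  fixes S :: "'a::euclidean_space set"
  assumes "0 \<in> interior S"
  shows "bounded (polar S)"
proof -
  obtain e where "e > 0" and e: "cball 0 e \<subseteq> S"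
    using assms by (auto simp: mem_interior_cball)
  have "norm y \<le> 1 / e" if y: "y \<in> polar S" for y
  proof (cases "y = 0")
    case False
    have "(e / norm y) *\<^sub>R y \<in> S"
      using e \<open>e > 0\<close> False by (intro subsetD[OF e]) simp
    then have "((e / norm y) *\<^sub>R y) \<bullet> y \<le> 1"
      using y by (auto simp: polar_def)
    then show ?thesis
      using False \<open>e > 0\<close> by (simp add: dot_square_norm power2_eq_square field_simps)
  qed (use \<open>e > 0\<close> in simp)
  then show ?thesis
    by (auto simp: bounded_iff)
qed

lemma zero_in_interior_polar:
  fixes S :: "'a::euclidean_space set"
  assumes "bounded S"
  shows "0 \<in> interior (polar S)"
proof -
  obtain B where "B > 0" and B: "\<And>x. x \<in> S \<Longrightarrow> norm x \<le> B"
    using assms by (auto simp: bounded_pos)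
  have "y \<in> polar S" if "norm y \<le> 1 / B" for y
  proof -
    have "x \<bullet> y \<le> 1" if "x \<in> S" for x
    proof -
      have "x \<bullet> y \<le> norm x * norm y"
        by (rule norm_cauchy_schwarz)
      also have "\<dots> \<le> B * (1 / B)"
        using B[OF that] \<open>norm y \<le> 1 / B\<close> \<open>B > 0\<close> by (intro mult_mono) auto
      finally show ?thesis
        using \<open>B > 0\<close> by simp
    qed
    then show ?thesis
      by (simp add: polar_def)
  qed
  then have "cball 0 (1 / B) \<subseteq> polar S"
    by auto
  then show ?thesis
    using \<open>B > 0\<close> by (auto simp: mem_interior_cball intro!: exI[of _ "1 / B"])
qed

text \<open>The generators alone define the polar, so it is a finite intersection of half-spaces;
  being bounded, this polyhedron is a polytope.\<close>

lemma polytope_polar: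
  fixes S :: "'a::euclidean_space set"
  assumes "polytope S" "0 \<in> interior S"
  shows "polytope (polar S)"
proof -
  obtain V where V: "finite V" "S = convex hull V"
    using assms(1) by (auto simp: polytope_def)
  have "polar S = \<Inter> ((\<lambda>x. {y. x \<bullet> y \<le> 1}) ` V)"
    unfolding V(2) polar_convex_hull by (auto simp: polar_def)
  then have "polyhedron (polar S)"
    using V(1) by (auto simp: polyhedron_halfspace_le)
  then show ?thesis
    by (simp add: polytope_eq_bounded_polyhedron bounded_polar assms(2))
qed

text \<open>Each point of \<open>F\<close> gives a valid inequality for the polar, hence a face
  where it is tight; the conjugate is the intersection of these faces.\<close>

lemma polar_face_face_of:
  assumes "F \<subseteq> S"
  shows "polar_face S F face_of polar S"
\<comment> \<open>An empty intersection would be \<open>UNIV\<close> instead of the polar.\<close>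
proof (cases "F = {}")
  case True
  then show ?thesis
    by (simp add: polar_face_def face_of_refl convex_polar)
next
  case False
  have "polar_face S F = \<Inter> ((\<lambda>x. polar S \<inter> {y. x \<bullet> y = 1}) ` F)"
    using False by (auto simp: polar_face_def)
  moreover have "\<dots> face_of polar S"
  proof (rule face_of_Inter)
    fix T assume "T \<in> (\<lambda>x. polar S \<inter> {y. x \<bullet> y = 1}) ` F"
    then obtain x where "x \<in> F" "T = polar S \<inter> {y. x \<bullet> y = 1}" by blast
    moreover have "x \<bullet> y \<le> 1" if "y \<in> polar S" for y
      using that \<open>x \<in> F\<close> assms by (auto simp: polar_def)
    ultimately show "T face_of polar S"
      by (simp add: face_of_Int_supporting_hyperplane_le convex_polar)
  qed (use False in simp)
  ultimately show ?thesis by simp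
qed

lemma polar_face_antimono: "F \<subseteq> G \<Longrightarrow> polar_face S G \<subseteq> polar_face S F"
  by (auto simp: polar_face_def)

text \<open>A proper face is exposed by some \<open>a \<bullet> x = b\<close>. Since the origin is
  interior, \<open>b > 0\<close>, so \<open>a\<close> scales to an element of the conjugate face,
  and that single element already cuts \<open>F\<close> out of \<open>S\<close>.\<close>

lemma polar_face_polar_face:
  fixes S :: "'a::euclidean_space set"
  assumes "polytope S" "0 \<in> interior S" "F face_of S"
  shows "polar_face (polar S) (polar_face S F) = F"
proof
  have "0 \<in> S"
    using assms(2) interior_subset by blast
  have bipolar: "polar (polar S) = S"
    using \<open>0 \<in> S\<close> assms(1) by (simp add: polar_polar polytope_imp_closed polytope_imp_convex)
  show "F \<subseteq> polar_face (polar S) (polar_face S F)"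
    using face_of_imp_subset[OF assms(3)] bipolar
    by (auto simp: polar_face_def inner_commute)
  show "polar_face (polar S) (polar_face S F) \<subseteq> F"
  proof (cases "F = S \<or> F = {}")
    case True
    moreover have "0 \<in> polar S"
      by (simp add: polar_def)
    ultimately show ?thesis
      by (auto simp: polar_face_def bipolar)
  next
    case False
    then obtain a b where "a \<noteq> 0" and ab: "S \<subseteq> {x. a \<bullet> x \<le> b}" "F = S \<inter> {x. a \<bullet> x = b}"
      using assms exposed_face_of_polyhedron[of S F] polytope_imp_polyhedron
      by (auto simp: exposed_face_of)
    have "b > 0"
    proof -
      obtain e where "e > 0" and e: "cball 0 e \<subseteq> S"
        using assms(2) by (auto simp: mem_interior_cball)
      \<comment> \<open>The ball around the origin reaches in direction \<open>a\<close>, where the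
        functional is positive.\<close>
      have "(e / norm a) *\<^sub>R a \<in> S"
        using \<open>e > 0\<close> by (intro subsetD[OF e]) simp
      then have "(e / norm a) * (a \<bullet> a) \<le> b"
        using ab(1) by auto
      moreover have "(e / norm a) * (a \<bullet> a) > 0"
        using \<open>e > 0\<close> \<open>a \<noteq> 0\<close> by simp
      ultimately show ?thesis by linarith
    qed
    define c where "c = (1 / b) *\<^sub>R a"
    have "c \<in> polar_face S F"
      using ab \<open>b > 0\<close> by (auto simp: c_def polar_face_def polar_def inner_commute field_simps)
    show ?thesis
    proof
      fix x assume "x \<in> polar_face (polar S) (polar_face S F)"
      with \<open>c \<in> polar_face S F\<close> bipolar have "x \<in> S" "c \<bullet> x = 1"
        by (auto simp: polar_face_def)
      then show "x \<in> F"
        using ab(2) \<open>b > 0\<close> by (simp add: c_def field_simps)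
    qed
  qed
qed

text \<open>The polar is again a polytope with the origin in its interior, so conjugation of faces
  is inverted by conjugation from the other side; both maps are antitone.\<close>

lemma dual_polytope_polar:
  fixes S :: "'a::euclidean_space set"
  assumes "polytope S" "0 \<in> interior S"
  shows "dual_polytope (polar S) S"
proof -
  have sub: "0 \<in> S"
    using assms(2) interior_subset by blast
  have bipolar: "polar (polar S) = S"
    using sub assms(1) by (simp add: polar_polar polytope_imp_closed polytope_imp_convex)
  have P: "polytope (polar S)" "0 \<in> interior (polar S)"
    using assms by (auto simp: polytope_polar zero_in_interior_polar polytope_imp_bounded)
  have inv: "polar_face S (polar_face (polar S) G) = G" if "G face_of polar S" for G
    using polar_face_polar_face[OF P that] by (simp add: bipolar)
  have "bij_betw (polar_face S) {F. F face_of S} {G. G face_of polar S}"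
  proof (rule bij_betw_byWitness[where f' = "polar_face (polar S)"])
    show "polar_face S ` {F. F face_of S} \<subseteq> {G. G face_of polar S}"
      using polar_face_face_of face_of_imp_subset by blast
    show "polar_face (polar S) ` {G. G face_of polar S} \<subseteq> {F. F face_of S}"
      using polar_face_face_of[of _ "polar S"] face_of_imp_subset by (force simp: bipolar)
  qed (use inv polar_face_polar_face[OF assms] in auto)
  moreover have "F \<subseteq> G \<longleftrightarrow> polar_face S G \<subseteq> polar_face S F"
    if "F face_of S" "G face_of S" for F G
    using polar_face_antimono polar_face_polar_face[OF assms] that by metis
  ultimately show ?thesis
    using assms(1) P(1) unfolding dual_polytope_def by blast
qed

subsection \<open>Polytopes with faces labelled by a simplicial complex\<close>

lemma complex_isomorphic_image:
  assumes "inj_on v (\<Union>K)"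
  shows "complex_isomorphic ((`) v ` K) K"
proof -
  let ?w = "inv_into (\<Union>K) v"
  have U: "\<Union>((`) v ` K) = v ` \<Union>K"
    by blast
  have "bij_betw ?w (v ` \<Union>K) (\<Union>K)"
    using assms bij_betw_imageI bij_betw_inv_into by blast
  moreover have "S \<in> (`) v ` K \<longleftrightarrow> ?w ` S \<in> K" if S: "S \<subseteq> v ` \<Union>K" for S
  proof
    assume "S \<in> (`) v ` K"
    then obtain C where "C \<in> K" "S = v ` C" by blast
    then show "?w ` S \<in> K"
      using assms by (simp add: inv_into_image_cancel Union_upper)
  next
    assume "?w ` S \<in> K"
    moreover have "S = v ` ?w ` S"
      using S by (simp add: image_inv_into_cancel)
    ultimately show "S \<in> (`) v ` K" by blast
  qed
  ultimately show ?thesis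
    unfolding complex_isomorphic_def U by blast
qed

lemma complex_isomorphic_trans:
  assumes "complex_isomorphic K L" "complex_isomorphic L M"
  shows "complex_isomorphic K M"
proof -
  obtain f where f: "bij_betw f (\<Union>K) (\<Union>L)" "\<And>S. S \<subseteq> \<Union>K \<Longrightarrow> S \<in> K \<longleftrightarrow> f ` S \<in> L"
    using assms(1) by (auto simp: complex_isomorphic_def)
  obtain g where g: "bij_betw g (\<Union>L) (\<Union>M)" "\<And>S. S \<subseteq> \<Union>L \<Longrightarrow> S \<in> L \<longleftrightarrow> g ` S \<in> M"
    using assms(2) by (auto simp: complex_isomorphic_def)
  have "S \<in> K \<longleftrightarrow> (g \<circ> f) ` S \<in> M" if S: "S \<subseteq> \<Union>K" for S
  proof -
    have "f ` S \<subseteq> \<Union>L"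
      using image_mono[OF S, of f] bij_betw_imp_surj_on[OF f(1)] by simp
    then show ?thesis
      using f(2)[OF S] g(2) by (simp add: image_comp)
  qed
  then show ?thesis
    unfolding complex_isomorphic_def using bij_betw_trans[OF f(1) g(1)] by blast
qed

text \<open>The setting is an isomorphism from a complex, ordered by inclusion, onto the proper
  faces of a polytope. The vertices and simplices are recovered from this order information.\<close>

context
  fixes Q :: "'a::euclidean_space set" and K :: "'b set set" and h :: "'b set \<Rightarrow> 'a set"
  assumes Q: "polytope Q"
    and K: "\<And>C D. C \<in> K \<Longrightarrow> D \<subseteq> C \<Longrightarrow> D \<in> K" "{} \<in> K"
    and h: "bij_betw h K {F. F face_of Q \<and> F \<noteq> Q}"
    and h_mono: "\<And>C D. C \<in> K \<Longrightarrow> D \<in> K \<Longrightarrow> h C \<subseteq> h D \<longleftrightarrow> C \<subseteq> D"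
begin

lemma labelled_face: "C \<in> K \<Longrightarrow> h C face_of Q \<and> h C \<noteq> Q"
  using bij_betwE[OF h] by simp

lemma face_labelled: "F face_of Q \<Longrightarrow> F \<noteq> Q \<Longrightarrow> \<exists>C\<in>K. F = h C"
  using bij_betw_imp_surj_on[OF h] by (metis (mono_tags, lifting) imageE mem_Collect_eq)

text \<open>Since \<open>K\<close> contains all subsets of \<open>C\<close>, the faces below
  \<open>h C\<close> form the Boolean lattice of these subsets.\<close>

lemma labelled_subface:
  assumes "C \<in> K" "F face_of Q" "F \<subseteq> h C"
  shows "\<exists>D\<in>K. D \<subseteq> C \<and> F = h D"
proof -
  have "F \<noteq> Q"
    using labelled_face[OF assms(1)] face_of_imp_subset assms(3) by blast
  then obtain D where D: "D \<in> K" "F = h D"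
    using assms(2) face_labelled by blast
  then have "D \<subseteq> C"
    using h_mono[OF D(1) assms(1)] assms(3) by simp
  then show ?thesis
    using D by blast
qed

lemma labelled_empty: "h {} = {}"
proof -
  obtain D where D: "D \<in> K" "{} = h D"
    using labelled_subface[OF K(2) empty_face_of] by blast
  then show ?thesis
    using h_mono[OF D(1) K(2)] h_mono[OF K(2) D(1)] by auto
qed

text \<open>An extreme point of \<open>h {s}\<close> is a face whose label is a nonempty subset of
  \<open>{s}\<close>, so it is all of \<open>h {s}\<close>.\<close>

lemma labelled_singleton:
  assumes "{s} \<in> K"
  shows "\<exists>x. h {s} = {x}"
proof -
  have F: "h {s} face_of Q"
    using labelled_face assms by blast
  have "h {s} \<noteq> {}"
    using h_mono[OF assms K(2)] labelled_empty by auto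
  moreover have "compact (h {s})" "convex (h {s})"
    using face_of_polytope_polytope[OF Q F] polytope_imp_compact polytope_imp_convex by auto
  ultimately obtain x where "x extreme_point_of h {s}"
    using extreme_point_exists_convex by metis
  then have "{x} face_of Q" "{x} \<subseteq> h {s}"
    by (simp_all add: extreme_point_of_face[OF F] face_of_singleton)
  then obtain D where "D \<subseteq> {s}" "{x} = h D"
    using labelled_subface[OF assms] by blast
  moreover have "D \<noteq> {}"
    using calculation labelled_empty by auto
  ultimately show ?thesis
    by (metis subset_singletonD)
qed

lemma singleton_in_complex:
  assumes "s \<in> \<Union>K"
  shows "{s} \<in> K"
proof -
  obtain C where "C \<in> K" "{s} \<subseteq> C"
    using assms by blast
  then show ?thesis
    by (rule K(1))
qed

definition vertex_of :: "'b \<Rightarrow> 'a" where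
  "vertex_of s = the_elem (h {s})"

lemma h_singleton:
  assumes "s \<in> \<Union>K"
  shows "h {s} = {vertex_of s}"
proof -
  obtain x where "h {s} = {x}"
    using labelled_singleton[OF singleton_in_complex[OF assms]] by blast
  then show ?thesis
    by (simp add: vertex_of_def)
qed

lemma inj_vertex_of: "inj_on vertex_of (\<Union>K)"
proof (rule inj_onI)
  fix s t assume "s \<in> \<Union>K" "t \<in> \<Union>K" "vertex_of s = vertex_of t"
  then have "h {s} \<subseteq> h {t}" "{s} \<in> K" "{t} \<in> K"
    by (simp_all only: h_singleton singleton_in_complex order_refl)
  then show "s = t"
    using h_mono[of "{s}" "{t}"] by simp
qed

text \<open>An extreme point is a one-point face with a nonempty label; any \<open>s\<close> in the
  label has \<open>h {s}\<close> inside that point, so the point is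
  \<open>vertex_of s\<close>.\<close>

lemma extreme_points_labelled:
  assumes C: "C \<in> K"
  shows "{x. x extreme_point_of h C} = vertex_of ` C"
proof -
  have F: "h C face_of Q"
    using labelled_face[OF C] by simp
  show ?thesis
  proof (intro equalityI subsetI)
    fix x assume "x \<in> {x. x extreme_point_of h C}"
    then have "{x} face_of Q" "{x} \<subseteq> h C"
      using F by (simp_all add: extreme_point_of_face face_of_singleton)
    then obtain D where D: "D \<in> K" "D \<subseteq> C" "{x} = h D"
      using labelled_subface[OF C] by blast
    then have "D \<noteq> {}"
      using labelled_empty by auto
    then obtain s where "s \<in> D" by blast
    then have sK: "s \<in> \<Union>K"
      using D(1) by blast
    then have "{vertex_of s} \<subseteq> {x}"
      unfolding D(3) h_singleton[OF sK, symmetric]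
      using h_mono[OF singleton_in_complex[OF sK] D(1)] \<open>s \<in> D\<close> by simp
    then have "x = vertex_of s" by simp
    then show "x \<in> vertex_of ` C"
      using \<open>s \<in> D\<close> D(2) by blast
  next
    fix x assume "x \<in> vertex_of ` C"
    then obtain s where s: "s \<in> C" "x = vertex_of s" by blast
    then have sK: "s \<in> \<Union>K" using C by blast
    have "{x} face_of Q" "{x} \<subseteq> h C"
      unfolding s(2) h_singleton[OF sK, symmetric]
      using labelled_face[OF singleton_in_complex[OF sK]] h_mono[OF singleton_in_complex[OF sK] C] s(1)
      by simp_all
    then show "x \<in> {x. x extreme_point_of h C}"
      using F by (simp add: extreme_point_of_face face_of_singleton)
  qed
qed

lemma labelled_hull:
  assumes "C \<in> K"
  shows "h C = convex hull (vertex_of ` C)"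
proof -
  have "polytope (h C)"
    using face_of_polytope_polytope[OF Q] labelled_face[OF assms] by blast
  then show ?thesis
    using Krein_Milman_Minkowski[of "h C"] extreme_points_labelled[OF assms]
    by (simp add: polytope_imp_compact polytope_imp_convex)
qed

text \<open>
  A Radon partition of the vertices of a proper face would produce two faces with disjoint labels
  and a common point; but the intersection of the two is the face labelled by the empty set,
  which is empty.
\<close>

lemma affine_independent_vertices:
  assumes C: "C \<in> K"
  shows "\<not> affine_dependent (vertex_of ` C)"
proof
  assume "affine_dependent (vertex_of ` C)"
  then obtain M N where MN: "M \<subseteq> vertex_of ` C" "N \<subseteq> vertex_of ` C" "M \<inter> N = {}"
      "convex hull M \<inter> convex hull N \<noteq> {}"
    by (rule Radon)
  obtain A B where AB: "A \<subseteq> C" "M = vertex_of ` A" "B \<subseteq> C" "N = vertex_of ` B"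
    using MN(1,2) by (meson subset_imageE)
  have K': "A \<in> K" "B \<in> K"
    using K(1)[OF C AB(1)] K(1)[OF C AB(3)] by auto
  have "h A \<inter> h B face_of Q"
    using K' labelled_face by (simp add: face_of_Int)
  then obtain D where D: "D \<in> K" "D \<subseteq> A" "h A \<inter> h B = h D"
    using labelled_subface[OF K'(1) _ inf_le1] by blast
  then have "D \<subseteq> B"
    using h_mono[OF D(1) K'(2)] by auto
  then have "D = {}"
    using D(2) MN(3) AB by blast
  then have "h A \<inter> h B = {}"
    using D(3) labelled_empty by simp
  then show False
    using MN(4) AB K' labelled_hull by simp
qed

lemma simplicial_if_labelled: "simplicial_polytope Q"
  unfolding simplicial_polytope_def
proof (intro conjI allI impI)
  fix F assume "F face_of Q \<and> F \<noteq> Q"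
  then obtain C where C: "C \<in> K" "F = h C"
    using face_labelled by blast
  \<comment> \<open>Dimensions of simplices are integers, so the empty face is a simplex of
    dimension -1.\<close>
  have "int (card (vertex_of ` C)) = (int (card (vertex_of ` C)) - 1) + 1"
    by simp
  then show "\<exists>k. k simplex F"
    unfolding simplex_def using C(2) affine_independent_vertices[OF C(1)] labelled_hull[OF C(1)]
    by blast
qed (rule Q)

lemma boundary_complex_if_labelled: "complex_isomorphic (boundary_complex Q) K"
proof -
  have "boundary_complex Q = (\<lambda>F. {v. v extreme_point_of F}) ` {F. F face_of Q \<and> F \<noteq> Q}"
    by (auto simp: boundary_complex_def)
  also have "\<dots> = (\<lambda>C. {v. v extreme_point_of h C}) ` K"
    using bij_betw_imp_surj_on[OF h] by (metis image_image)
  also have "\<dots> = (`) vertex_of ` K"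
    using extreme_points_labelled by (rule image_cong[OF refl])
  finally have "boundary_complex Q = (`) vertex_of ` K" .
  then show ?thesis
    by (simp add: complex_isomorphic_image inj_vertex_of)
qed

end

subsection \<open>Sign vectors and the type B permutohedron\<close>

definition signed_perms :: "(real ^ 'n) set" where
  "signed_perms = {v. \<exists>p. bij_betw p UNIV {1..CARD('n)} \<and> (\<forall>i. \<bar>v $ i\<bar> = real (p i))}"

text \<open>Ordered by \<open>sign_le\<close>, these are the nonempty proper faces of the
  cross-polytope.\<close>

definition sign_vectors :: "(real ^ 'n) set" where
  "sign_vectors = {\<sigma>. \<sigma> \<noteq> 0 \<and> (\<forall>i. \<sigma> $ i \<in> {-1, 0, 1})}"

definition sign_le :: "real ^ 'n \<Rightarrow> real ^ 'n \<Rightarrow> bool" where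
  "sign_le \<sigma> \<tau> \<longleftrightarrow> (\<forall>i. \<sigma> $ i \<noteq> 0 \<longrightarrow> \<tau> $ i = \<sigma> $ i)"

definition sign_chains :: "(real ^ 'n) set set" where
  "sign_chains = {C. C \<subseteq> sign_vectors \<and> (\<forall>\<sigma>\<in>C. \<forall>\<tau>\<in>C. sign_le \<sigma> \<tau> \<or> sign_le \<tau> \<sigma>)}"

text \<open>For a signed permutation vector, the combinatorial form of lying on the supporting
  hyperplane with normal \<open>\<sigma>\<close>.\<close>

definition compatible :: "real ^ 'n \<Rightarrow> real ^ 'n \<Rightarrow> bool" where
  "compatible v \<sigma> \<longleftrightarrow>
     (\<forall>i. \<sigma> $ i \<noteq> 0 \<longrightarrow> 0 < \<sigma> $ i * v $ i \<and> (\<forall>j. \<sigma> $ j = 0 \<longrightarrow> \<bar>v $ j\<bar> < \<bar>v $ i\<bar>))"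

text \<open>The cutoff between the \<open>k\<close> largest numbers of \<open>{1..n}\<close> and the
  rest, with \<open>k\<close> the size of the support.\<close>

definition threshold :: "real ^ 'n \<Rightarrow> real" where
  "threshold \<sigma> = real (CARD('n) - card {i. \<sigma> $ i \<noteq> 0})"

text \<open>The sum of the \<open>k\<close> largest numbers of \<open>{1..n}\<close>, for a support
  of size \<open>k\<close>. Positive parts make it comparable with an inner product one coordinate
  at a time.\<close>

definition sign_bound :: "real ^ 'n \<Rightarrow> real" where
  "sign_bound \<sigma> = threshold \<sigma> * real (card {i. \<sigma> $ i \<noteq> 0}) +
     (\<Sum>j = 1..CARD('n). max (real j - threshold \<sigma>) 0)"

text \<open>The empty chain gives the whole permutohedron.\<close>

definition chain_face :: "(real ^ 'n) set \<Rightarrow> (real ^ 'n) set" where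
  "chain_face C = {x \<in> permutohedron_B. \<forall>\<sigma>\<in>C. \<sigma> \<bullet> x = sign_bound \<sigma>}"

section \<open>Generators of the permutohedron and finiteness\<close>

lemma permutohedron_B_eq: "permutohedron_B = convex hull (signed_perms :: (real ^ 'n) set)"
proof -
  have "v \<in> signed_perms \<longleftrightarrow> (\<exists>p s. v = (\<chi> i. s i * real (p i)) \<and>
      bij_betw p UNIV {1..CARD('n)} \<and> (\<forall>i. s i \<in> {1, -1}))" (is "_ \<longleftrightarrow> ?R") for v :: "real ^ 'n"
  proof
    assume "v \<in> signed_perms"
    then obtain p where p: "bij_betw p UNIV {1..CARD('n)}" "\<And>i. \<bar>v $ i\<bar> = real (p i)"
      by (auto simp: signed_perms_def)
    have "v = (\<chi> i. (if v $ i \<ge> 0 then 1 else -1) * real (p i))"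
      using p(2) by (auto simp: vec_eq_iff p(2)[symmetric])
    then show ?R
      using p(1) by (intro exI[of _ p] exI[of _ "\<lambda>i. if v $ i \<ge> 0 then 1 else -1"]) auto
  next
    assume ?R
    then obtain p s where ps: "v = (\<chi> i. s i * real (p i))" "bij_betw p UNIV {1..CARD('n)}"
        "\<And>i. s i \<in> {1, -1}" by blast
    have "\<bar>v $ i\<bar> = real (p i)" for i
      using ps(3)[of i] by (auto simp: ps(1))
    then show "v \<in> signed_perms"
      using ps(2) by (auto simp: signed_perms_def)
  qed
  then show ?thesis
    unfolding permutohedron_B_def by (intro arg_cong[where f = "(hull) convex"]) auto
qed

lemma finite_signed_perms: "finite (signed_perms :: (real ^ 'n) set)"
proof -
  let ?F = "{s. \<forall>i::'n. s i \<in> real ` {1..CARD('n)} \<union> uminus ` real ` {1..CARD('n)}}"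
  have "finite ?F"
    using finite_PiE[of "UNIV :: 'n set" "\<lambda>_. real ` {1..CARD('n)} \<union> uminus ` real ` {1..CARD('n)}"]
    by (simp add: PiE_UNIV_domain Pi_def)
  then have "finite (vec_lambda ` ?F)" by (rule finite_imageI)
  moreover have "signed_perms \<subseteq> vec_lambda ` ?F"
  proof
    fix v :: "real ^ 'n" assume "v \<in> signed_perms"
    then obtain p where p: "bij_betw p UNIV {1..CARD('n)}" "\<And>i. \<bar>v $ i\<bar> = real (p i)"
      by (auto simp: signed_perms_def)
    have "v $ i \<in> real ` {1..CARD('n)} \<union> uminus ` real ` {1..CARD('n)}" for i
    proof -
      have "real (p i) \<in> real ` {1..CARD('n)}"
        using bij_betwE[OF p(1)] by blast
      moreover have "v $ i = real (p i) \<or> v $ i = - real (p i)"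
        using p(2)[of i] by linarith
      ultimately show ?thesis by auto
    qed
    then show "v \<in> vec_lambda ` ?F"
      by (intro image_eqI[of _ _ "vec_nth v"]) auto
  qed
  ultimately show ?thesis
    by (rule rev_finite_subset)
qed

lemma finite_sign_vectors: "finite (sign_vectors :: (real ^ 'n) set)"
proof (rule finite_imageD)
  let ?f = "\<lambda>\<sigma> :: real ^ 'n. ({i. \<sigma> $ i = 1}, {i. \<sigma> $ i = -1})"
  show "finite (?f ` sign_vectors)"
    by (rule finite_subset[OF subset_UNIV]) simp
  show "inj_on ?f sign_vectors"
  proof (rule inj_onI)
    fix \<sigma> \<tau> :: "real ^ 'n"
    assume *: "\<sigma> \<in> sign_vectors" "\<tau> \<in> sign_vectors" "?f \<sigma> = ?f \<tau>"
    have "\<sigma> $ i = \<tau> $ i" for i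
    proof -
      have "\<sigma> $ i = 1 \<longleftrightarrow> \<tau> $ i = 1" "\<sigma> $ i = -1 \<longleftrightarrow> \<tau> $ i = -1"
        using *(3) by blast+
      moreover have "\<sigma> $ i \<in> {-1, 0, 1}" "\<tau> $ i \<in> {-1, 0, 1}"
        using *(1,2) by (auto simp: sign_vectors_def)
      ultimately show ?thesis by auto
    qed
    then show "\<sigma> = \<tau>"
      by (simp add: vec_eq_iff)
  qed
qed

lemma finite_sign_chain: "C \<in> sign_chains \<Longrightarrow> finite C"
  using finite_sign_vectors by (auto simp: sign_chains_def intro: finite_subset)

section \<open>Supporting hyperplanes with sign vectors as normals\<close>

lemma threshold_le_if_above:
  fixes p :: "'n::finite \<Rightarrow> nat"
  assumes "bij_betw p UNIV {1..CARD('n)}" "\<And>j. j \<notin> A \<Longrightarrow> p j < p i"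
  shows "CARD('n) - card A \<le> p i"
proof -
  have "p ` (- A) \<subseteq> {1..<p i}"
    using assms bij_betwE[OF assms(1)] by fastforce
  then have "card (p ` (- A)) \<le> card {1..<p i}"
    by (rule card_mono[rotated]) simp
  moreover have "card (p ` (- A)) = CARD('n) - card A"
    using assms(1) by (subst card_image)
      (auto simp: bij_betw_def Compl_eq_Diff_UNIV card_Diff_subset intro: inj_on_subset)
  ultimately show ?thesis by simp
qed

text \<open>The values on \<open>A\<close> are distinct and exceed \<open>p j\<close>, so there are
  at most \<open>n - p j\<close> of them. The preceding bound counts the values off \<open>A\<close>
  below \<open>p i\<close> in the same way.\<close>

lemma le_threshold_if_below:
  fixes p :: "'n::finite \<Rightarrow> nat"
  assumes "bij_betw p UNIV {1..CARD('n)}" "\<And>i. i \<in> A \<Longrightarrow> p j < p i"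
  shows "p j \<le> CARD('n) - card A"
proof -
  have "p ` A \<subseteq> {p j<..CARD('n)}"
    using assms bij_betwE[OF assms(1)] by fastforce
  then have "card (p ` A) \<le> card {p j<..CARD('n)}"
    by (rule card_mono[rotated]) simp
  moreover have "card (p ` A) = card A"
    using assms(1) by (intro card_image) (auto simp: bij_betw_def intro: inj_on_subset)
  moreover have "p j \<le> CARD('n)"
    using bij_betwE[OF assms(1)] by auto
  ultimately show ?thesis by simp
qed

text \<open>
  Every set \<open>A\<close> of \<open>k\<close> coordinates satisfies
  \<open>(\<Sum>i\<in>A. \<bar>v $ i\<bar> - t) \<le> (\<Sum>i. max (\<bar>v $ i\<bar> - t) 0)\<close>. The threshold \<open>t = n - k\<close> makes this sharp
  exactly when \<open>A\<close> carries the \<open>k\<close> largest absolute values.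
\<close>

lemma inner_sign_vector:
  fixes v \<sigma> :: "real ^ 'n"
  assumes v: "v \<in> signed_perms" and \<sigma>: "\<sigma> \<in> sign_vectors"
  shows "\<sigma> \<bullet> v \<le> sign_bound \<sigma>" and "\<sigma> \<bullet> v = sign_bound \<sigma> \<longleftrightarrow> compatible v \<sigma>"
proof -
  obtain p where p: "bij_betw p UNIV {1..CARD('n)}" "\<And>i. \<bar>v $ i\<bar> = real (p i)"
    using v by (auto simp: signed_perms_def)
  define t where "t = threshold \<sigma>"
  \<comment> \<open>\<open>d i\<close> is the slack at coordinate \<open>i\<close>; the slacks are
    nonnegative and add up to the gap between \<open>sign_bound \<sigma>\<close> and the inner
    product.\<close>
  define d where "d i = max (\<bar>v $ i\<bar> - t) 0 - (\<sigma> $ i * v $ i - t * \<bar>\<sigma> $ i\<bar>)" for i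
  have \<sigma>_cases: "\<sigma> $ i = -1 \<or> \<sigma> $ i = 0 \<or> \<sigma> $ i = 1" for i
    using \<sigma> by (auto simp: sign_vectors_def)
  have v_ge: "\<bar>v $ i\<bar> \<ge> 1" for i
    using bij_betwE[OF p(1)] by (simp add: p(2))
  have "t \<ge> 0"
    by (simp add: t_def threshold_def)
  have d_nonneg: "d i \<ge> 0" for i
    using \<sigma>_cases[of i] by (auto simp: d_def)
  \<comment> \<open>That \<open>v $ i\<close> is nonzero makes the sign condition strict.\<close>
  have d_eq_0: "d i = 0 \<longleftrightarrow>
      (if \<sigma> $ i = 0 then \<bar>v $ i\<bar> \<le> t else 0 < \<sigma> $ i * v $ i \<and> t \<le> \<bar>v $ i\<bar>)" for i
    using \<sigma>_cases[of i] v_ge[of i] \<open>t \<ge> 0\<close> by (auto simp: d_def max_def abs_if split: if_splits)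
  have "(\<Sum>j = 1..CARD('n). max (real j - t) 0) = (\<Sum>i\<in>UNIV. max (\<bar>v $ i\<bar> - t) 0)"
    by (simp add: p(2) sum.reindex_bij_betw[OF p(1), of "\<lambda>j. max (real j - t) 0"])
  moreover have "real (card {i. \<sigma> $ i \<noteq> 0}) = (\<Sum>i\<in>UNIV. \<bar>\<sigma> $ i\<bar>)"
  proof -
    have "(\<Sum>i\<in>UNIV. \<bar>\<sigma> $ i\<bar>) = (\<Sum>i\<in>UNIV. if \<sigma> $ i \<noteq> 0 then 1 else 0)"
    proof (rule sum.cong[OF refl])
      fix i
      show "\<bar>\<sigma> $ i\<bar> = (if \<sigma> $ i \<noteq> 0 then 1 else 0)"
        using \<sigma>_cases[of i] by auto
    qed
    then show ?thesis
      by (simp add: sum.If_cases)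
  qed
  ultimately have gap: "sign_bound \<sigma> - \<sigma> \<bullet> v = (\<Sum>i\<in>UNIV. d i)"
    by (simp add: sign_bound_def t_def[symmetric] d_def inner_vec_def sum_subtractf sum_distrib_left)
  show "\<sigma> \<bullet> v \<le> sign_bound \<sigma>"
    using gap sum_nonneg[of UNIV d] d_nonneg by simp
  have "\<sigma> \<bullet> v = sign_bound \<sigma> \<longleftrightarrow> (\<forall>i. d i = 0)"
    using gap d_nonneg sum_nonneg_eq_0_iff[of UNIV d] by auto
  also have "\<dots> \<longleftrightarrow> compatible v \<sigma>"
  proof
    assume d: "\<forall>i. d i = 0"
    show "compatible v \<sigma>"
      unfolding compatible_def
    proof (intro allI impI conjI)
      fix i j assume i: "\<sigma> $ i \<noteq> 0"
      then show "0 < \<sigma> $ i * v $ i"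
        using d d_eq_0 by simp
      assume j: "\<sigma> $ j = 0"
      have "\<bar>v $ j\<bar> \<le> \<bar>v $ i\<bar>"
        using d d_eq_0[of i] d_eq_0[of j] i j by simp
      \<comment> \<open>The threshold gives only a weak inequality; injectivity of \<open>p\<close>
        makes it strict.\<close>
      moreover have "p i \<noteq> p j"
        using p(1) i j by (auto simp: bij_betw_def inj_eq)
      ultimately show "\<bar>v $ j\<bar> < \<bar>v $ i\<bar>"
        by (simp add: p(2))
    qed
  next
    assume c: "compatible v \<sigma>"
    show "\<forall>i. d i = 0"
    proof
      fix i
      show "d i = 0"
      proof (cases "\<sigma> $ i = 0")
        case True
        then have "p i \<le> CARD('n) - card {i. \<sigma> $ i \<noteq> 0}"
          using c by (intro le_threshold_if_below[OF p(1)]) (auto simp: compatible_def p(2))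
        then show ?thesis
          using True by (simp add: d_eq_0 p(2) t_def threshold_def)
      next
        case False
        then have "CARD('n) - card {i. \<sigma> $ i \<noteq> 0} \<le> p i"
          using c by (intro threshold_le_if_above[OF p(1)]) (auto simp: compatible_def p(2))
        then show ?thesis
          using False c by (simp add: d_eq_0 p(2) t_def threshold_def compatible_def)
      qed
    qed
  qed
  finally show "\<sigma> \<bullet> v = sign_bound \<sigma> \<longleftrightarrow> compatible v \<sigma>" .
qed

section \<open>Vertices in prescribed position relative to a chain\<close>

lemma ex_ranking:
  fixes w :: "'n::finite \<Rightarrow> nat"
  shows "\<exists>p. bij_betw p UNIV {1..CARD('n)} \<and> (\<forall>i j. w i < w j \<longrightarrow> p i < p j)"
proof -
  let ?N = "CARD('n)"
  obtain f where f: "bij_betw f (UNIV :: 'n set) {0..<?N}"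
    using ex_bij_betw_finite_nat[of "UNIV :: 'n set"] by auto
  have f_less: "f i < ?N" for i
    using bij_betwE[OF f] by auto
  \<comment> \<open>Scaling by \<open>?N\<close> and adding an enumeration with values below
    \<open>?N\<close> breaks all ties of \<open>w\<close> without disturbing strict
    comparisons.\<close>
  define u where "u i = w i * ?N + f i" for i
  have u_less: "u i < u j" if "w i < w j" for i j
  proof -
    have "u i < Suc (w i) * ?N"
      using f_less by (simp add: u_def)
    also have "\<dots> \<le> w j * ?N"
      using that by (intro mult_le_mono1) simp
    finally show ?thesis by (simp add: u_def)
  qed
  have u_inj: "i = j" if "u i = u j" for i j
  proof -
    have "w i = w j"
      using that u_less by (metis less_irrefl linorder_neqE_nat)
    then have "f i = f j"
      using that by (simp add: u_def)
    then show ?thesis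
      using f by (auto simp: bij_betw_def inj_eq)
  qed
  \<comment> \<open>Counting with \<open>\<le>\<close> includes \<open>i\<close> itself, so ranks
    start at 1.\<close>
  define p where "p i = card {j. u j \<le> u i}" for i
  have p_less: "p i < p j" if "u i < u j" for i j
    unfolding p_def
  proof (rule psubset_card_mono)
    show "{k. u k \<le> u i} \<subset> {k. u k \<le> u j}"
      using that by (auto simp: psubset_eq set_eq_iff not_le[symmetric])
  qed simp
  have "inj p"
  proof (rule injI)
    fix i j assume "p i = p j"
    then show "i = j"
      using p_less u_inj by (metis less_irrefl linorder_neqE_nat)
  qed
  moreover have "p ` UNIV = {1..?N}"
  proof (rule card_subset_eq)
    have "p i \<le> ?N" for i
      unfolding p_def by (rule card_mono) auto
    moreover have "p i \<ge> 1" for i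
    proof -
      have "card {i} \<le> p i"
        unfolding p_def by (rule card_mono) auto
      then show ?thesis by simp
    qed
    ultimately show "p ` UNIV \<subseteq> {1..?N}" by auto
    show "card (p ` UNIV) = card {1..?N}"
      using \<open>inj p\<close> by (simp add: card_image)
  qed simp
  ultimately have "bij_betw p UNIV {1..?N}"
    by (simp add: bij_betw_def)
  then show ?thesis
    using p_less u_less by blast
qed

lemma sign_chain_agree:
  assumes "C \<in> sign_chains" "\<sigma> \<in> C" "\<rho> \<in> C" "\<sigma> $ i \<noteq> 0" "\<rho> $ i \<noteq> 0"
  shows "\<rho> $ i = \<sigma> $ i"
proof -
  have "sign_le \<sigma> \<rho> \<or> sign_le \<rho> \<sigma>"
    using assms(1-3) by (auto simp: sign_chains_def)
  then show ?thesis
    using assms(4,5) by (auto simp: sign_le_def)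
qed

text \<open>
  The coordinates are ranked by the number of members of the chain that contain them in their
  support. Ties are broken, and free signs chosen, against \<open>\<tau>\<close>.
\<close>

lemma ex_compatible_separating:
  fixes C :: "(real ^ 'n) set"
  assumes C: "C \<in> sign_chains"
  shows "\<exists>v\<in>signed_perms. (\<forall>\<sigma>\<in>C. compatible v \<sigma>) \<and>
    (\<tau> \<in> sign_vectors \<longrightarrow> compatible v \<tau> \<longrightarrow> \<tau> \<in> C)"
proof -
  define N where "N i = {\<sigma> \<in> C. \<sigma> $ i \<noteq> 0}" for i
  have fin: "finite (N i)" for i
    using finite_sign_chain[OF C] by (simp add: N_def)
  \<comment> \<open>The factor 2 keeps the tie-breaking term from overturning a strict comparison of
    counts; on equal counts, coordinates off the support of \<open>\<tau>\<close> rank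
    higher.\<close>
  define w where "w i = 2 * card (N i) + (if \<tau> $ i \<noteq> 0 then 0 else 1)" for i
  obtain p where p: "bij_betw p UNIV {1..CARD('n)}" "\<And>i j. w i < w j \<Longrightarrow> p i < p j"
    using ex_ranking[of w] by blast
  have p_less: "p j < p i" if "N j \<subset> N i" for i j
  proof -
    have "card (N j) < card (N i)"
      using that by (simp add: psubset_card_mono fin)
    then show ?thesis
      by (intro p(2)) (simp add: w_def)
  qed
  have p_pos: "real (p i) > 0" for i
    using bij_betwE[OF p(1)] by (simp add: Suc_le_eq)
  \<comment> \<open>Members of a chain agree on common supports, so the first two tests cannot
    conflict. For a sign vector \<open>\<tau>\<close> the fallback is \<open>- \<tau> $ i\<close> on
    its support.\<close>
  define s :: "'n \<Rightarrow> real" where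
    "s i = (if \<exists>\<sigma>\<in>C. \<sigma> $ i = 1 then 1 else if \<exists>\<sigma>\<in>C. \<sigma> $ i = -1 then -1
            else if \<tau> $ i = 1 then -1 else 1)" for i
  have C_cases: "\<sigma> $ i = -1 \<or> \<sigma> $ i = 0 \<or> \<sigma> $ i = 1" if "\<sigma> \<in> C" for \<sigma> i
    using that C by (auto simp: sign_chains_def sign_vectors_def)
  have s_C: "s i = \<sigma> $ i" if "\<sigma> \<in> N i" for \<sigma> i
  proof -
    have "\<rho> $ i = \<sigma> $ i" if "\<rho> \<in> C" "\<rho> $ i \<noteq> 0" for \<rho>
      using sign_chain_agree[OF C _ that(1) _ that(2), of \<sigma>] \<open>\<sigma> \<in> N i\<close> by (simp add: N_def)
    moreover have "\<sigma> \<in> C" "\<sigma> $ i \<noteq> 0"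
      using that by (auto simp: N_def)
    ultimately show ?thesis
      using C_cases[of \<sigma> i] unfolding s_def by (smt (verit, best))
  qed
  define v :: "real ^ 'n" where "v = (\<chi> i. s i * real (p i))"
  have s_pm: "s i = 1 \<or> s i = -1" for i
    by (simp add: s_def)
  have abs_v: "\<bar>v $ i\<bar> = real (p i)" for i
    using s_pm[of i] by (auto simp: v_def)
  have "v \<in> signed_perms"
    using p(1) abs_v by (auto simp: signed_perms_def)
  moreover have "compatible v \<sigma>" if \<sigma>: "\<sigma> \<in> C" for \<sigma>
    unfolding compatible_def
  proof (intro allI impI conjI)
    fix i j assume i: "\<sigma> $ i \<noteq> 0"
    then have "\<sigma> \<in> N i"
      using \<sigma> by (simp add: N_def)
    then show "0 < \<sigma> $ i * v $ i"
      using s_C[of \<sigma> i] s_pm[of i] p_pos[of i] by (auto simp: v_def)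
    assume j: "\<sigma> $ j = 0"
    \<comment> \<open>A member with \<open>j\<close> in its support cannot lie below
      \<open>\<sigma>\<close>, so it lies above \<open>\<sigma>\<close> and has \<open>i\<close> in
      its support.\<close>
    have "N j \<subseteq> N i"
    proof
      fix \<rho> assume "\<rho> \<in> N j"
      then have "\<rho> \<in> C" "\<not> sign_le \<rho> \<sigma>"
        using j by (auto simp: N_def sign_le_def)
      then have "sign_le \<sigma> \<rho>"
        using C \<sigma> by (auto simp: sign_chains_def)
      then show "\<rho> \<in> N i"
        using i \<open>\<rho> \<in> C\<close> by (simp add: N_def sign_le_def)
    qed
    moreover have "\<sigma> \<notin> N j"
      using j by (simp add: N_def)
    ultimately have "N j \<subset> N i"
      using \<open>\<sigma> \<in> N i\<close> by blast
    then show "\<bar>v $ j\<bar> < \<bar>v $ i\<bar>"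
      using p_less by (simp add: abs_v)
  qed
  moreover have "\<tau> \<in> C" if \<tau>: "\<tau> \<in> sign_vectors" and comp: "compatible v \<tau>"
  proof -
    have \<tau>_cases: "\<tau> $ i = -1 \<or> \<tau> $ i = 0 \<or> \<tau> $ i = 1" for i
      using \<tau> by (auto simp: sign_vectors_def)
    have \<tau>_s: "\<tau> $ i = s i" if "\<tau> $ i \<noteq> 0" for i
    proof -
      have "0 < \<tau> $ i * s i * real (p i)"
        using comp that by (simp add: compatible_def v_def mult.assoc)
      then have "0 < \<tau> $ i * s i"
        using p_pos by (simp add: zero_less_mult_iff)
      then show ?thesis
        using \<tau>_cases[of i] s_pm[of i] that by auto
    qed
    \<comment> \<open>Otherwise the fallback sign at \<open>i\<close> would oppose
      \<open>\<tau>\<close>.\<close>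
    have N_nonempty: "N i \<noteq> {}" if "\<tau> $ i \<noteq> 0" for i
    proof
      assume "N i = {}"
      then have "\<not> (\<exists>\<sigma>\<in>C. \<sigma> $ i = 1)" "\<not> (\<exists>\<sigma>\<in>C. \<sigma> $ i = -1)"
        by (auto simp: N_def)
      then have "s i = - \<tau> $ i"
        using \<tau>_cases[of i] that by (auto simp: s_def)
      then show False
        using \<tau>_s[OF that] that by simp
    qed
    \<comment> \<open>A coordinate off the support of \<open>\<tau>\<close> with at least the count
      of \<open>i\<close> would outrank \<open>i\<close>, so the support is upward closed with
      respect to counts.\<close>
    have upward: "\<tau> $ j \<noteq> 0" if "\<tau> $ i \<noteq> 0" "card (N i) \<le> card (N j)" for i j
    proof
      assume "\<tau> $ j = 0"
      then have "w i < w j"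
        using that by (simp add: w_def)
      then have "p i < p j"
        by (rule p(2))
      moreover have "p j < p i"
        using comp that(1) \<open>\<tau> $ j = 0\<close> by (simp add: compatible_def abs_v)
      ultimately show False by simp
    qed
    \<comment> \<open>The candidate for \<open>\<tau>\<close>: take a coordinate \<open>i\<close> of
      minimal count in its support, then the chain member of least support among those that contain
      \<open>i\<close>.\<close>
    have "{i. \<tau> $ i \<noteq> 0} \<noteq> {}"
      using \<tau> by (auto simp: sign_vectors_def vec_eq_iff)
    then obtain i where i: "\<tau> $ i \<noteq> 0" "\<And>j. \<tau> $ j \<noteq> 0 \<Longrightarrow> card (N i) \<le> card (N j)"
      using ex_min_if_finite[of "(\<lambda>i. card (N i)) ` {i. \<tau> $ i \<noteq> 0}"]
      by (auto simp: not_less)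
    obtain \<sigma> where \<sigma>: "\<sigma> \<in> N i" "\<And>\<rho>. \<rho> \<in> N i \<Longrightarrow> card {j. \<sigma> $ j \<noteq> 0} \<le> card {j. \<rho> $ j \<noteq> 0}"
      using ex_min_if_finite[of "(\<lambda>\<sigma>. card {j. \<sigma> $ j \<noteq> 0}) ` N i"] fin N_nonempty[OF i(1)]
      by (auto simp: not_less)
    have "\<sigma> \<in> C"
      using \<sigma>(1) by (simp add: N_def)
    have le: "sign_le \<sigma> \<rho>" if "\<rho> \<in> N i" for \<rho>
    proof (rule ccontr)
      assume neg: "\<not> sign_le \<sigma> \<rho>"
      then have "sign_le \<rho> \<sigma>"
        using C that \<open>\<sigma> \<in> C\<close> by (auto simp: sign_chains_def N_def)
      then have "{j. \<rho> $ j \<noteq> 0} \<subseteq> {j. \<sigma> $ j \<noteq> 0}"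
        by (auto simp: sign_le_def)
      then have "{j. \<rho> $ j \<noteq> 0} = {j. \<sigma> $ j \<noteq> 0}"
        using \<sigma>(2)[OF that] by (simp add: card_seteq)
      then have "sign_le \<sigma> \<rho>"
        using \<open>sign_le \<rho> \<sigma>\<close> by (auto simp: sign_le_def)
      then show False
        using neg by simp
    qed
    \<comment> \<open>Since \<open>\<sigma>\<close> lies below every member of \<open>N i\<close>,
      its coordinates have at least the count of \<open>i\<close>. Coordinates off
      \<open>\<sigma>\<close> have strictly smaller counts, which minimality of \<open>i\<close>
      keeps out of the support of \<open>\<tau>\<close>.\<close>
    have supp: "\<tau> $ j \<noteq> 0 \<longleftrightarrow> \<sigma> $ j \<noteq> 0" for j
    proof
      assume "\<sigma> $ j \<noteq> 0"
      then have "N i \<subseteq> N j"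
        using le by (auto simp: N_def sign_le_def)
      then show "\<tau> $ j \<noteq> 0"
        using upward[OF i(1)] card_mono[OF fin] by blast
    next
      assume \<tau>j: "\<tau> $ j \<noteq> 0"
      show "\<sigma> $ j \<noteq> 0"
      proof
        assume "\<sigma> $ j = 0"
        have "N j \<subseteq> N i"
        proof
          fix \<rho> assume "\<rho> \<in> N j"
          then have "\<rho> \<in> C" "\<not> sign_le \<rho> \<sigma>"
            using \<open>\<sigma> $ j = 0\<close> by (auto simp: N_def sign_le_def)
          then have "sign_le \<sigma> \<rho>"
            using C \<open>\<sigma> \<in> C\<close> by (auto simp: sign_chains_def)
          then show "\<rho> \<in> N i"
            using \<sigma>(1) \<open>\<rho> \<in> C\<close> by (auto simp: N_def sign_le_def)
        qed
        moreover have "\<sigma> \<notin> N j"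
          using \<open>\<sigma> $ j = 0\<close> by (simp add: N_def)
        ultimately have "card (N j) < card (N i)"
          using \<sigma>(1) fin by (intro psubset_card_mono) auto
        then show False
          using i(2)[OF \<tau>j] by simp
      qed
    qed
    have "\<tau> $ j = \<sigma> $ j" for j
      using supp[of j] \<tau>_s[of j] s_C[of \<sigma> j] \<open>\<sigma> \<in> C\<close> by (cases "\<sigma> $ j = 0") (auto simp: N_def)
    then have "\<tau> = \<sigma>"
      by (simp add: vec_eq_iff)
    then show ?thesis
      using \<open>\<sigma> \<in> C\<close> by simp
  qed
  ultimately show ?thesis by blast
qed

section \<open>Decomposition of functionals along chains\<close>

definition sgn_vec :: "real ^ 'n \<Rightarrow> real ^ 'n" where
  "sgn_vec c = (\<chi> i. sgn (c $ i))"

lemma sgn_vec_in_sign_vectors: "c \<noteq> 0 \<Longrightarrow> sgn_vec c \<in> sign_vectors"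
  by (auto simp: sign_vectors_def sgn_vec_def vec_eq_iff sgn_real_def)

lemma sign_le_trans: "sign_le \<rho> \<sigma> \<Longrightarrow> sign_le \<sigma> \<tau> \<Longrightarrow> sign_le \<rho> \<tau>"
  by (auto simp: sign_le_def)

text \<open>
  Subtracting the smallest nonzero absolute value of \<open>c\<close> times its sign vector keeps all remaining
  signs and creates at least one new zero.
\<close>

lemma sign_chain_decomposition:
  fixes c :: "real ^ 'n"
  shows "\<exists>C\<in>sign_chains. \<exists>l. (\<forall>\<sigma>\<in>C. 0 < l \<sigma> \<and> sign_le \<sigma> (sgn_vec c)) \<and>
    c = (\<Sum>\<sigma>\<in>C. l \<sigma> *\<^sub>R \<sigma>)"
\<comment> \<open>The bound \<open>sign_le \<sigma> (sgn_vec c)\<close> is carried through the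
  induction to make the newly added sign vector comparable with the members already found.\<close>
proof (induction "card {i. c $ i \<noteq> 0}" arbitrary: c rule: less_induct)
  case less
  show ?case
  proof (cases "c = 0")
    case True
    then show ?thesis
      by (intro bexI[of _ "{}"]) (auto simp: sign_chains_def)
  next
    case False
    define m where "m = Min ((\<lambda>i. \<bar>c $ i\<bar>) ` {i. c $ i \<noteq> 0})"
    have ne: "{i. c $ i \<noteq> 0} \<noteq> {}"
      using False by (auto simp: vec_eq_iff)
    then obtain k where k: "c $ k \<noteq> 0" "\<bar>c $ k\<bar> = m"
      using Min_in[of "(\<lambda>i. \<bar>c $ i\<bar>) ` {i. c $ i \<noteq> 0}"] unfolding m_def by fastforce
    have m_le: "m \<le> \<bar>c $ i\<bar>" if "c $ i \<noteq> 0" for i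
      using that unfolding m_def by (intro Min_le) auto
    have "m > 0"
      using k by linarith
    define c' where "c' = c - m *\<^sub>R sgn_vec c"
    have c'_nth: "c' $ i = c $ i - m * sgn (c $ i)" for i
      by (simp add: c'_def sgn_vec_def)
    have c'_sgn: "c $ i \<noteq> 0 \<and> sgn (c' $ i) = sgn (c $ i)" if "c' $ i \<noteq> 0" for i
      using that m_le[of i] \<open>m > 0\<close> by (auto simp: c'_nth sgn_real_def split: if_splits)
    then have c'_le: "sign_le (sgn_vec c') (sgn_vec c)"
      by (auto simp: sign_le_def sgn_vec_def sgn_0_0)
    have "c' $ k = 0"
      using k by (auto simp: c'_nth sgn_real_def)
    then have "{i. c' $ i \<noteq> 0} \<subset> {i. c $ i \<noteq> 0}"
      using c'_sgn k(1) by auto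
    then have "card {i. c' $ i \<noteq> 0} < card {i. c $ i \<noteq> 0}"
      by (simp add: psubset_card_mono)
    from less[OF this] obtain C l where C: "C \<in> sign_chains"
        "\<And>\<sigma>. \<sigma> \<in> C \<Longrightarrow> 0 < l \<sigma> \<and> sign_le \<sigma> (sgn_vec c')" "c' = (\<Sum>\<sigma>\<in>C. l \<sigma> *\<^sub>R \<sigma>)"
      by blast
    have le: "sign_le \<sigma> (sgn_vec c)" if "\<sigma> \<in> C" for \<sigma>
      using C(2)[OF that] c'_le sign_le_trans by blast
    \<comment> \<open>Members of \<open>C\<close> vanish at \<open>k\<close>, where
      \<open>sgn_vec c\<close> does not; hence updating \<open>l\<close> leaves the old coefficients
      alone.\<close>
    have fresh: "sgn_vec c \<notin> C"
    proof
      assume "sgn_vec c \<in> C"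
      then have "sign_le (sgn_vec c) (sgn_vec c')"
        using C(2) by blast
      then show False
        using k(1) \<open>c' $ k = 0\<close> by (auto simp: sign_le_def sgn_vec_def sgn_0_0 dest!: spec[of _ k])
    qed
    let ?C = "insert (sgn_vec c) C" and ?l = "l(sgn_vec c := m)"
    have refl: "sign_le (sgn_vec c) (sgn_vec c)"
      by (simp add: sign_le_def)
    have "?C \<in> sign_chains"
      using C(1) le refl sgn_vec_in_sign_vectors[OF False] unfolding sign_chains_def by blast
    moreover have "\<forall>\<sigma>\<in>?C. 0 < ?l \<sigma> \<and> sign_le \<sigma> (sgn_vec c)"
      using C(2) le refl \<open>m > 0\<close> by simp
    moreover have "c = (\<Sum>\<sigma>\<in>?C. ?l \<sigma> *\<^sub>R \<sigma>)"
    proof -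
      have "(\<Sum>\<sigma>\<in>C. ?l \<sigma> *\<^sub>R \<sigma>) = c'"
        unfolding C(3) using fresh by (intro sum.cong) auto
      then have "(\<Sum>\<sigma>\<in>?C. ?l \<sigma> *\<^sub>R \<sigma>) = m *\<^sub>R sgn_vec c + c'"
        using fresh finite_sign_chain[OF C(1)] by simp
      then show ?thesis
        by (simp add: c'_def)
    qed
    ultimately show ?thesis by blast
  qed
qed

section \<open>Faces of the permutohedron and chains of sign vectors\<close>

lemma polytope_permutohedron_B: "polytope (permutohedron_B :: (real ^ 'n) set)"
  unfolding permutohedron_B_eq using finite_signed_perms polytope_def by blast

lemma inner_sign_vector_le:
  fixes x :: "real ^ 'n"
  assumes "x \<in> permutohedron_B" "\<sigma> \<in> sign_vectors"
  shows "\<sigma> \<bullet> x \<le> sign_bound \<sigma>"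
proof -
  have "convex hull signed_perms \<subseteq> {x. \<sigma> \<bullet> x \<le> sign_bound \<sigma>}"
    using inner_sign_vector(1)[OF _ assms(2)] by (intro hull_minimal) (auto simp: convex_halfspace_le)
  then show ?thesis
    using assms(1) by (auto simp: permutohedron_B_eq)
qed

text \<open>A positive combination of valid inequalities is valid, and it is tight exactly where
  every one of them is tight.\<close>

lemma chain_face_supporting:
  fixes C :: "(real ^ 'n) set"
  assumes C: "C \<in> sign_chains" and l: "\<And>\<sigma>. \<sigma> \<in> C \<Longrightarrow> 0 < l \<sigma>"
  defines "c \<equiv> \<Sum>\<sigma>\<in>C. l \<sigma> *\<^sub>R \<sigma>" and "b \<equiv> \<Sum>\<sigma>\<in>C. l \<sigma> * sign_bound \<sigma>"
  shows "x \<in> permutohedron_B \<Longrightarrow> c \<bullet> x \<le> b"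
    and "chain_face C = permutohedron_B \<inter> {x. c \<bullet> x = b}"
proof -
  have inner: "c \<bullet> x = (\<Sum>\<sigma>\<in>C. l \<sigma> * (\<sigma> \<bullet> x))" for x
    by (simp add: c_def inner_sum_left)
  have le: "l \<sigma> * (\<sigma> \<bullet> x) \<le> l \<sigma> * sign_bound \<sigma>"
    if "x \<in> permutohedron_B" "\<sigma> \<in> C" for x \<sigma>
    using that C l[OF that(2)] inner_sign_vector_le[OF that(1)]
    by (intro mult_left_mono) (auto simp: sign_chains_def)
  show "c \<bullet> x \<le> b" if "x \<in> permutohedron_B" for x
    unfolding inner b_def using le[OF that] by (rule sum_mono)
  have "c \<bullet> x = b \<longleftrightarrow> (\<forall>\<sigma>\<in>C. \<sigma> \<bullet> x = sign_bound \<sigma>)" if x: "x \<in> permutohedron_B" for x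
  proof
    assume eq: "c \<bullet> x = b"
    have "(\<Sum>\<sigma>\<in>C. l \<sigma> * sign_bound \<sigma> - l \<sigma> * (\<sigma> \<bullet> x)) = 0"
      using eq by (simp add: inner b_def sum_subtractf)
    then have "\<forall>\<sigma>\<in>C. l \<sigma> * sign_bound \<sigma> - l \<sigma> * (\<sigma> \<bullet> x) = 0"
      using le[OF x] finite_sign_chain[OF C] by (subst (asm) sum_nonneg_eq_0_iff) auto
    then show "\<forall>\<sigma>\<in>C. \<sigma> \<bullet> x = sign_bound \<sigma>"
      using l by fastforce
  qed (simp add: inner b_def)
  then show "chain_face C = permutohedron_B \<inter> {x. c \<bullet> x = b}"
    by (auto simp: chain_face_def)
qed

lemma chain_face_face_of:
  assumes "C \<in> sign_chains"
  shows "chain_face C face_of permutohedron_B"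
  using chain_face_supporting[OF assms, of "\<lambda>_. 1"]
  by (simp add: face_of_Int_supporting_hyperplane_le polytope_imp_convex[OF polytope_permutohedron_B])

lemma signed_perm_in_chain_face:
  assumes "v \<in> signed_perms" "C \<in> sign_chains"
  shows "v \<in> chain_face C \<longleftrightarrow> (\<forall>\<sigma>\<in>C. compatible v \<sigma>)"
proof -
  have "v \<in> permutohedron_B"
    using assms(1) by (simp add: permutohedron_B_eq hull_inc)
  moreover have "\<sigma> \<bullet> v = sign_bound \<sigma> \<longleftrightarrow> compatible v \<sigma>" if "\<sigma> \<in> C" for \<sigma>
    using that assms by (intro inner_sign_vector(2)) (auto simp: sign_chains_def)
  ultimately show ?thesis
    by (auto simp: chain_face_def)
qed

lemma chain_face_nonempty:
  assumes "C \<in> sign_chains"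
  shows "chain_face C \<noteq> {}"
  using ex_compatible_separating[OF assms] signed_perm_in_chain_face[OF _ assms] by blast

text \<open>The separating vertex for \<open>C\<close> and \<open>\<tau> \<in> D\<close> lies in
  \<open>chain_face C\<close>; if it also lies in \<open>chain_face D\<close>, it is compatible with
  \<open>\<tau>\<close>, which forces \<open>\<tau> \<in> C\<close>.\<close>

lemma chain_face_subset_iff:
  assumes C: "C \<in> sign_chains" and D: "D \<in> sign_chains"
  shows "chain_face C \<subseteq> chain_face D \<longleftrightarrow> D \<subseteq> C"
proof
  assume sub: "chain_face C \<subseteq> chain_face D"
  show "D \<subseteq> C"
  proof
    fix \<tau> assume "\<tau> \<in> D"
    obtain v where v: "v \<in> signed_perms" "\<forall>\<sigma>\<in>C. compatible v \<sigma>"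
        "\<tau> \<in> sign_vectors \<Longrightarrow> compatible v \<tau> \<Longrightarrow> \<tau> \<in> C"
      using ex_compatible_separating[OF C] by blast
    then have "v \<in> chain_face D"
      using sub signed_perm_in_chain_face[OF v(1) C] by blast
    then have "compatible v \<tau>"
      using signed_perm_in_chain_face[OF v(1) D] \<open>\<tau> \<in> D\<close> by blast
    then show "\<tau> \<in> C"
      using v(3) D \<open>\<tau> \<in> D\<close> by (auto simp: sign_chains_def)
  qed
qed (auto simp: chain_face_def)

lemma face_is_chain_face:
  fixes F :: "(real ^ 'n) set"
  assumes "F face_of permutohedron_B" "F \<noteq> {}"
  shows "\<exists>C\<in>sign_chains. F = chain_face C"
proof -
  have "F exposed_face_of permutohedron_B"
    using assms(1) by (simp add: exposed_face_of_polyhedron polytope_imp_polyhedron polytope_permutohedron_B)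
  then obtain c b where cb: "permutohedron_B \<subseteq> {x. c \<bullet> x \<le> b}" "F = permutohedron_B \<inter> {x. c \<bullet> x = b}"
    by (auto simp: exposed_face_of_def)
  obtain C l where C: "C \<in> sign_chains" "\<And>\<sigma>. \<sigma> \<in> C \<Longrightarrow> 0 < l \<sigma>" "c = (\<Sum>\<sigma>\<in>C. l \<sigma> *\<^sub>R \<sigma>)"
    using sign_chain_decomposition[of c] by blast
  define b' where "b' = (\<Sum>\<sigma>\<in>C. l \<sigma> * sign_bound \<sigma>)"
  note supp = chain_face_supporting[OF C(1), of l, folded C(3) b'_def, OF C(2)]
  \<comment> \<open>Both \<open>b\<close> and \<open>b'\<close> are the maximum of \<open>c\<close>
    over the permutohedron, attained on \<open>F\<close> and on \<open>chain_face C\<close>, so they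
    agree.\<close>
  obtain x where "x \<in> permutohedron_B" "c \<bullet> x = b"
    using assms(2) cb(2) by blast
  then have "b \<le> b'"
    using supp(1) by blast
  moreover obtain y where "y \<in> permutohedron_B" "c \<bullet> y = b'"
    using chain_face_nonempty[OF C(1)] supp(2) by blast
  then have "b' \<le> b"
    using cb(1) by blast
  ultimately show ?thesis
    using supp(2) cb(2) C(1) by auto
qed

section \<open>The origin as an interior point\<close>

lemma zero_in_interior_permutohedron_B: "0 \<in> interior (permutohedron_B :: (real ^ 'n) set)"
proof -
  let ?P = "permutohedron_B :: (real ^ 'n) set"
  have conv: "convex ?P"
    by (simp add: polytope_imp_convex polytope_permutohedron_B)
  have symm: "uminus ` ?P = ?P"
  proof -
    have "uminus ` signed_perms = (signed_perms :: (real ^ 'n) set)"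
    proof
      show "uminus ` signed_perms \<subseteq> (signed_perms :: (real ^ 'n) set)"
        by (auto simp: signed_perms_def)
      show "signed_perms \<subseteq> uminus ` (signed_perms :: (real ^ 'n) set)"
      proof
        fix v :: "real ^ 'n" assume "v \<in> signed_perms"
        then have "- v \<in> signed_perms"
          by (simp add: signed_perms_def)
        then show "v \<in> uminus ` signed_perms"
          by (rule image_eqI[rotated]) simp
      qed
    qed
    then show ?thesis
      unfolding permutohedron_B_eq using convex_hull_linear_image[OF linear_uminus] by metis
  qed
  have "interior ?P \<noteq> {}"
  proof
    assume "interior ?P = {}"
    then obtain a b where ab: "a \<noteq> 0" "?P \<subseteq> {x. a \<bullet> x = b}"
      using empty_interior_subset_hyperplane[OF conv] by blast
    obtain i where i: "a $ i \<noteq> 0"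
      using ab(1) by (auto simp: vec_eq_iff)
    obtain p where p: "bij_betw p (UNIV :: 'n set) {1..CARD('n)}"
      using ex_ranking by blast
    \<comment> \<open>\<open>w\<close> flips one sign of \<open>v\<close>, so \<open>v - w\<close>
      lies along axis \<open>i\<close>, and a hyperplane with normal \<open>a\<close> through both
      points would force \<open>a $ i = 0\<close>.\<close>
    define v :: "real ^ 'n" where "v = (\<chi> j. real (p j))"
    define w :: "real ^ 'n" where "w = (\<chi> j. if j = i then - real (p j) else real (p j))"
    have "v \<in> signed_perms" "w \<in> signed_perms"
      using p by (auto simp: signed_perms_def v_def w_def)
    then have "v \<in> ?P" "w \<in> ?P"
      by (auto simp: permutohedron_B_eq hull_inc)
    then have "a \<bullet> (v - w) = 0"
      using ab(2) by (auto simp: inner_diff_right)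
    moreover have "v - w = axis i (2 * real (p i))"
      by (simp add: v_def w_def vec_eq_iff axis_def)
    ultimately have "p i = 0"
      using i by (simp add: inner_axis)
    moreover have "p i \<in> {1..CARD('n)}"
      using bij_betwE[OF p] by blast
    ultimately show False by simp
  qed
  then obtain x where x: "x \<in> interior ?P" by blast
  have "interior ?P = uminus ` interior ?P"
    using symm interior_negations[of ?P] by simp
  then have "- x \<in> interior ?P"
    using x by blast
  \<comment> \<open>The interior is convex and symmetric; the origin is the midpoint of
    \<open>x\<close> and \<open>- x\<close>.\<close>
  then have "(1/2) *\<^sub>R x + (1/2) *\<^sub>R (- x) \<in> interior ?P"
    using x convex_interior[OF conv] by (intro convexD) auto
  then show ?thesis by simp
qed

section \<open>Intervals of a Boolean algebra as sign vectors\<close>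

lemma interval_in_subset_iff:
  assumes "A \<subseteq> B" "B \<subseteq> U" "A' \<subseteq> B'" "B' \<subseteq> U"
  shows "interval_in (Pow U) A B \<subseteq> interval_in (Pow U) A' B' \<longleftrightarrow> A' \<subseteq> A \<and> B \<subseteq> B'"
proof
  assume sub: "interval_in (Pow U) A B \<subseteq> interval_in (Pow U) A' B'"
  \<comment> \<open>The two endpoints suffice as test elements.\<close>
  have "A \<in> interval_in (Pow U) A B" "B \<in> interval_in (Pow U) A B"
    using assms by (auto simp: interval_in_def)
  then show "A' \<subseteq> A \<and> B \<subseteq> B'"
    using sub by (auto simp: interval_in_def)
qed (auto simp: interval_in_def)

text \<open>\<open>e\<close> carries the index type to the ground set of the Boolean algebra, which
  is finally \<open>{1..n}\<close>.\<close>

definition sign_interval :: "('n \<Rightarrow> 'a) \<Rightarrow> real ^ 'n \<Rightarrow> 'a set set" where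
  "sign_interval e \<sigma> = interval_in (Pow (range e)) (e ` {i. \<sigma> $ i = 1}) (e ` {i. \<sigma> $ i \<noteq> -1})"

lemma sign_interval_subset_iff:
  fixes e :: "'n::finite \<Rightarrow> 'a"
  assumes "inj e" "\<And>i. \<sigma> $ i \<in> {-1, 0, 1}" "\<And>i. \<tau> $ i \<in> {-1, 0, 1}"
  shows "sign_interval e \<sigma> \<subseteq> sign_interval e \<tau> \<longleftrightarrow> sign_le \<tau> \<sigma>"
proof -
  have sub: "e ` {i. \<rho> $ i = 1} \<subseteq> e ` {i. \<rho> $ i \<noteq> -1}" for \<rho> :: "real ^ 'n"
    by (intro image_mono) auto
  have "sign_interval e \<sigma> \<subseteq> sign_interval e \<tau> \<longleftrightarrow>
      (\<forall>i. (\<tau> $ i = 1 \<longrightarrow> \<sigma> $ i = 1) \<and> (\<tau> $ i = -1 \<longrightarrow> \<sigma> $ i = -1))"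
    unfolding sign_interval_def
    by (subst interval_in_subset_iff) (auto simp: sub inj_image_subset_iff[OF assms(1)])
  also have "\<dots> \<longleftrightarrow> sign_le \<tau> \<sigma>"
    using assms(3) unfolding sign_le_def by (auto; metis)
  finally show ?thesis .
qed

text \<open>An interval determines its endpoints, and these determine the signs; the zero vector
  encodes the removed maximum.\<close>

lemma sign_interval_bij:
  fixes e :: "'n::finite \<Rightarrow> 'a"
  assumes "inj e"
  defines "U \<equiv> range e"
  shows "bij_betw (sign_interval e) sign_vectors
    (interval_poset (Pow U) - {{}, interval_in (Pow U) {} U})"
proof -
  let ?X = "interval_poset (Pow U) - {{}, interval_in (Pow U) {} U}"
  let ?I = "sign_interval e"
  have sub: "e ` {i. \<rho> $ i = 1} \<subseteq> e ` {i. \<rho> $ i \<noteq> -1}" "e ` {i. \<rho> $ i \<noteq> -1} \<subseteq> U"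
    for \<rho> :: "real ^ 'n"
    by (auto simp: U_def)
  have vals: "\<sigma> $ i \<in> {-1, 0, 1}" if "\<sigma> \<in> insert 0 sign_vectors" for \<sigma> :: "real ^ 'n" and i
    using that by (auto simp: sign_vectors_def)
  \<comment> \<open>Zero is included so that injectivity also keeps nonzero sign vectors from being
    sent to the maximum.\<close>
  have eq_iff: "?I \<sigma> = ?I \<tau> \<longleftrightarrow> \<sigma> = \<tau>"
    if "\<sigma> \<in> insert 0 sign_vectors" "\<tau> \<in> insert 0 sign_vectors" for \<sigma> \<tau>
  proof
    assume "?I \<sigma> = ?I \<tau>"
    then have "sign_le \<sigma> \<tau>" "sign_le \<tau> \<sigma>"
      using sign_interval_subset_iff[OF assms(1)] vals that by (metis order_refl)+
    then have "\<sigma> $ i = \<tau> $ i" for i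
      by (metis sign_le_def)
    then show "\<sigma> = \<tau>"
      by (simp add: vec_eq_iff)
  qed simp
  have I0: "?I 0 = interval_in (Pow U) {} U"
    by (simp add: sign_interval_def U_def)
  have nonempty: "e ` {i. \<sigma> $ i = 1} \<in> ?I \<sigma>" for \<sigma>
    using sub by (auto simp: sign_interval_def interval_in_def U_def)
  have surj: "\<exists>\<sigma>\<in>insert 0 sign_vectors. J = ?I \<sigma>"
    if J: "J \<in> interval_poset (Pow U)" "J \<noteq> {}" for J
  proof -
    obtain A B where AB: "A \<subseteq> B" "B \<subseteq> U" "J = interval_in (Pow U) A B"
      using J by (auto simp: interval_poset_def)
    define \<sigma> :: "real ^ 'n" where "\<sigma> = (\<chi> i. if e i \<in> A then 1 else if e i \<in> B then 0 else -1)"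
    have "e ` {i. \<sigma> $ i = 1} = A" "e ` {i. \<sigma> $ i \<noteq> -1} = B"
      using AB(1,2) by (auto simp: \<sigma>_def U_def split: if_splits)
    then have "J = ?I \<sigma>"
      by (simp add: sign_interval_def AB(3) U_def)
    moreover have "\<sigma> \<in> insert 0 sign_vectors"
      by (auto simp: sign_vectors_def \<sigma>_def)
    ultimately show ?thesis by blast
  qed
  have "inj_on ?I sign_vectors"
    by (rule inj_onI) (simp add: eq_iff)
  moreover have "?I ` sign_vectors = ?X"
  proof
    show "?I ` sign_vectors \<subseteq> ?X"
    proof
      fix J assume "J \<in> ?I ` sign_vectors"
      then obtain \<sigma> where \<sigma>: "\<sigma> \<in> sign_vectors" "J = ?I \<sigma>" by blast
      have "J \<in> interval_poset (Pow U)"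
        using sub[of \<sigma>] unfolding \<sigma>(2) sign_interval_def U_def interval_poset_def by blast
      moreover have "J \<noteq> {}"
        using nonempty[of \<sigma>] \<sigma>(2) by blast
      moreover have "J \<noteq> ?I 0"
        using eq_iff[of \<sigma> 0] \<sigma> by (auto simp: sign_vectors_def)
      ultimately show "J \<in> ?X"
        by (simp add: I0)
    qed
    show "?X \<subseteq> ?I ` sign_vectors"
    proof
      fix J assume J: "J \<in> ?X"
      then obtain \<sigma> where "\<sigma> \<in> insert 0 sign_vectors" "J = ?I \<sigma>"
        using surj by blast
      then show "J \<in> ?I ` sign_vectors"
        using J I0 by auto
    qed
  qed
  ultimately show ?thesis
    by (simp add: bij_betw_def)
qed

lemma Union_sign_chains: "\<Union>sign_chains = (sign_vectors :: (real ^ 'n) set)"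
proof
  show "sign_vectors \<subseteq> \<Union>(sign_chains :: (real ^ 'n) set set)"
  proof
    fix \<sigma> :: "real ^ 'n" assume "\<sigma> \<in> sign_vectors"
    then have "{\<sigma>} \<in> sign_chains"
      by (simp add: sign_chains_def sign_le_def)
    then show "\<sigma> \<in> \<Union>sign_chains" by blast
  qed
qed (auto simp: sign_chains_def)

lemma Union_order_complex: "\<Union>(order_complex X) = X"
proof
  show "X \<subseteq> \<Union>(order_complex X)"
  proof
    fix x assume "x \<in> X"
    then have "{x} \<in> order_complex X"
      by (simp add: order_complex_def chain_def)
    then show "x \<in> \<Union>(order_complex X)" by blast
  qed
qed (auto simp: order_complex_def)

text \<open>\<open>sign_interval\<close> reverses the order, which does not affect being a
  chain.\<close>

lemma sign_chains_isomorphic_order_complex: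
  fixes e :: "'n::finite \<Rightarrow> 'a"
  assumes "inj e"
  defines "U \<equiv> range e"
  shows "complex_isomorphic (sign_chains :: (real ^ 'n) set set)
    (order_complex (interval_poset (Pow U) - {{}, interval_in (Pow U) {} U}))"
proof -
  let ?X = "interval_poset (Pow U) - {{}, interval_in (Pow U) {} U}"
  have bij: "bij_betw (sign_interval e) sign_vectors ?X"
    unfolding U_def by (rule sign_interval_bij[OF assms(1)])
  have iff: "sign_interval e \<sigma> \<subseteq> sign_interval e \<tau> \<longleftrightarrow> sign_le \<tau> \<sigma>"
    if "\<sigma> \<in> sign_vectors" "\<tau> \<in> sign_vectors" for \<sigma> \<tau>
    using that by (intro sign_interval_subset_iff[OF assms(1)]) (auto simp: sign_vectors_def)
  have "S \<in> sign_chains \<longleftrightarrow> sign_interval e ` S \<in> order_complex ?X"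
    if S: "S \<subseteq> sign_vectors" for S
  proof -
    have "sign_interval e ` S \<subseteq> ?X"
      using image_mono[OF S] bij_betw_imp_surj_on[OF bij] by metis
    then have "sign_interval e ` S \<in> order_complex ?X \<longleftrightarrow>
        (\<forall>\<sigma>\<in>S. \<forall>\<tau>\<in>S. sign_interval e \<sigma> \<subseteq> sign_interval e \<tau> \<or> sign_interval e \<tau> \<subseteq> sign_interval e \<sigma>)"
      by (simp add: order_complex_def chain_def)
    also have "\<dots> \<longleftrightarrow> (\<forall>\<sigma>\<in>S. \<forall>\<tau>\<in>S. sign_le \<tau> \<sigma> \<or> sign_le \<sigma> \<tau>)"
      using iff S by (meson subsetD)
    also have "\<dots> \<longleftrightarrow> S \<in> sign_chains"
      using S by (auto simp: sign_chains_def)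
    finally show ?thesis by simp
  qed
  then show ?thesis
    unfolding complex_isomorphic_def Union_sign_chains Union_order_complex using bij by blast
qed

section \<open>Faces of an arbitrary dual polytope\<close>

lemma dual_face_labelling:
  fixes Q :: "'b::euclidean_space set"
  assumes "dual_polytope Q (permutohedron_B :: (real ^ 'n) set)"
  obtains h where "bij_betw h (sign_chains :: (real ^ 'n) set set) {G. G face_of Q \<and> G \<noteq> Q}"
    "\<And>C D. C \<in> sign_chains \<Longrightarrow> D \<in> sign_chains \<Longrightarrow> h C \<subseteq> h D \<longleftrightarrow> C \<subseteq> D"
proof -
  let ?P = "permutohedron_B :: (real ^ 'n) set"
  obtain f where f: "bij_betw f {F. F face_of ?P} {G. G face_of Q}"
      "\<And>F G. F face_of ?P \<Longrightarrow> G face_of ?P \<Longrightarrow> F \<subseteq> G \<longleftrightarrow> f G \<subseteq> f F"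
    using assms by (auto simp: dual_polytope_def)
  have "convex Q"
    using assms by (simp add: dual_polytope_def polytope_imp_convex)
  \<comment> \<open>\<open>Q\<close> is the image of some face \<open>E\<close>; since
    \<open>{}\<close> lies in \<open>E\<close>, reversal gives
    \<open>Q \<subseteq> f {}\<close>.\<close>
  then obtain E where "E face_of ?P" "f E = Q"
    using bij_betw_imp_surj_on[OF f(1)] face_of_refl by (metis (mono_tags, lifting) imageE mem_Collect_eq)
  moreover have "f {} face_of Q"
    using bij_betwE[OF f(1)] by simp
  ultimately have f_empty: "f {} = Q"
    using f(2)[of "{}" E] face_of_imp_subset by fastforce
  have "chain_face ` sign_chains = {F. F face_of ?P} - {{}}"
    using chain_face_face_of chain_face_nonempty face_is_chain_face by blast
  moreover have "inj_on chain_face (sign_chains :: (real ^ 'n) set set)"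
    by (rule inj_onI) (metis chain_face_subset_iff order_refl subset_antisym)
  ultimately have "bij_betw chain_face sign_chains ({F. F face_of ?P} - {{}})"
    by (simp add: bij_betw_def)
  moreover have "bij_betw f ({F. F face_of ?P} - {{}}) ({G. G face_of Q} - {Q})"
    using bij_betw_DiffI[OF f(1), of "{{}}" "{Q}"] f_empty \<open>convex Q\<close>
    by (simp add: face_of_refl)
  ultimately have "bij_betw (f \<circ> chain_face) sign_chains ({G. G face_of Q} - {Q})"
    by (rule bij_betw_trans)
  moreover have "{G. G face_of Q} - {Q} = {G. G face_of Q \<and> G \<noteq> Q}"
    by blast
  \<comment> \<open>Two order reversals compose to an order-preserving labelling.\<close>
  moreover have "(f \<circ> chain_face) C \<subseteq> (f \<circ> chain_face) D \<longleftrightarrow> C \<subseteq> D"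
    if "C \<in> sign_chains" "D \<in> sign_chains" for C D
    using f(2)[OF chain_face_face_of[OF that(2)] chain_face_face_of[OF that(1)]]
      chain_face_subset_iff[OF that(2,1)] by simp
  ultimately show thesis
    using that by metis
qed

theorem proposition3p2:
  fixes n :: nat
  assumes "n \<ge> 1" and "CARD('n::finite) = n"
  shows "(\<exists>Q :: (real ^ 'n) set. dual_polytope Q (permutohedron_B :: (real ^ 'n) set)) \<and>
    (\<forall>Q :: 'b::euclidean_space set. dual_polytope Q (permutohedron_B :: (real ^ 'n) set) \<longrightarrow>
       simplicial_polytope Q \<and>
       complex_isomorphic (boundary_complex Q)
         (order_complex (interval_poset (Pow {1..n}) -
            {{}, interval_in (Pow {1..n}) {} {1..n}})))"
proof (intro conjI allI impI)
  show "\<exists>Q :: (real ^ 'n) set. dual_polytope Q (permutohedron_B :: (real ^ 'n) set)"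
    using dual_polytope_polar[OF polytope_permutohedron_B zero_in_interior_permutohedron_B] by blast
next
  fix Q :: "'b set"
  assume dual: "dual_polytope Q (permutohedron_B :: (real ^ 'n) set)"
  then have Q: "polytope Q"
    by (simp add: dual_polytope_def)
  obtain h where h: "bij_betw h (sign_chains :: (real ^ 'n) set set) {G. G face_of Q \<and> G \<noteq> Q}"
    "\<And>C D. C \<in> sign_chains \<Longrightarrow> D \<in> sign_chains \<Longrightarrow> h C \<subseteq> h D \<longleftrightarrow> C \<subseteq> D"
    using dual_face_labelling[OF dual] by blast
  have K: "D \<in> sign_chains" if "C \<in> sign_chains" "D \<subseteq> C" for C D :: "(real ^ 'n) set"
    using that unfolding sign_chains_def by blast
  have K0: "{} \<in> sign_chains"
    by (simp add: sign_chains_def)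
  show "simplicial_polytope Q"
    by (rule simplicial_if_labelled[OF Q K K0 h])
  have boundary: "complex_isomorphic (boundary_complex Q) (sign_chains :: (real ^ 'n) set set)"
    by (rule boundary_complex_if_labelled[OF Q K K0 h])
  obtain e :: "'n \<Rightarrow> nat" where "bij_betw e UNIV {1..n}"
    using finite_same_card_bij[of "UNIV :: 'n set" "{1..n}"] assms(2) by auto
  then have "inj e" "range e = {1..n}"
    by (auto simp: bij_betw_def)
  then have "complex_isomorphic (sign_chains :: (real ^ 'n) set set) (order_complex
      (interval_poset (Pow {1..n}) - {{}, interval_in (Pow {1..n}) {} {1..n}}))"
    using sign_chains_isomorphic_order_complex[of e] by simp
  with boundary show "complex_isomorphic (boundary_complex Q) (order_complex
      (interval_poset (Pow {1..n}) - {{}, interval_in (Pow {1..n}) {} {1..n}}))"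
    by (rule complex_isomorphic_trans)
qed

end
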